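(* Let $N\ge2$, $g_1,\dots,g_N>0$ (not necessarily distinct), $f_{ij}=g_i+g_j$ for $i\ne j$. Let $y\in\overline{\mathcal S}=\{y\in[0,1]^N:\sum_iy_i=1\}$ and $h\in E=\{v\in\mathbb R^N:\sum_iv_i=0\}$. Then the equation $$B(y)v=h,\qquad v\in E,$$ has a unique solution. As an operator $E\to E$, $$\bigl(B(y)|_E\bigr)^{-1}=\Bigl[-D_s+\frac1{R_0(y)}(D_sy)\bigl(\mathbf 1^{\sf T}D_s\bigr)\Bigr]\Big|_E,$$ where $s=\sum_ig_iy_i$, $D_s=\operatorname{diag}\bigl(\frac1{g_1+s},\dots,\frac1{g_N+s}\bigr)$, $\mathbf 1=(1,\dots,1)^{\sf T}$ and $R_0(y)=\sum_{i=1}^N\frac{y_i}{g_i+s}>0$. Equivalently, $$v_i=-\frac{h_i}{g_i+s}+\frac{y_i}{R_0(y)(g_i+s)}\sum_{r=1}^N\frac{h_r}{g_r+s},\qquad i=1,\dots,N.$$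
   Context: The Maxwell--Stefan matrix $B(y)\in\mathbb R^{N\times N}$ is $B_{ij}(y)=y_if_{ij}$ for $i\ne j$ and $B_{ii}(y)=-\sum_{\ell\ne i}f_{i\ell}y_\ell$; it maps $E$ into $E$. *)

theory Defs
  imports "HOL-Analysis.Analysis"
begin

text \<open>The index set \<open>{1, \<dots>, N}\<close> is a finite type \<open>'n\<close> with \<open>N = CARD('n)\<close>.\<close>

definition zero_sum :: "(real ^ 'n) set"
  where "zero_sum = {v. (\<Sum>i\<in>UNIV. v $ i) = 0}"

definition closed_simplex :: "(real ^ 'n) set"
  where "closed_simplex = {y. (\<forall>i. 0 \<le> y $ i \<and> y $ i \<le> 1) \<and> (\<Sum>i\<in>UNIV. y $ i) = 1}"

text \<open>Only the off-diagonal entries of the coefficients \<open>f\<close> enter this matrix.\<close>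

definition MS_matrix :: "('n \<Rightarrow> 'n \<Rightarrow> real) \<Rightarrow> real ^ 'n \<Rightarrow> real ^ 'n ^ 'n"
  where "MS_matrix f y =
    (\<chi> i j. if i = j then - (\<Sum>l\<in>UNIV - {i}. f i l * y $ l) else y $ i * f i j)"

definition diag_matrix :: "('n \<Rightarrow> real) \<Rightarrow> real ^ 'n ^ 'n"
  where "diag_matrix d = (\<chi> i j. if i = j then d i else 0)"

definition g_mean :: "('n \<Rightarrow> real) \<Rightarrow> real ^ 'n \<Rightarrow> real"
  where "g_mean g y = (\<Sum>i\<in>UNIV. g i * y $ i)"

definition D_mat :: "('n \<Rightarrow> real) \<Rightarrow> real \<Rightarrow> real ^ 'n ^ 'n"
  where "D_mat g s = diag_matrix (\<lambda>i. 1 / (g i + s))"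

definition R0 :: "('n \<Rightarrow> real) \<Rightarrow> real ^ 'n \<Rightarrow> real"
  where "R0 g y = (\<Sum>i\<in>UNIV. y $ i / (g i + g_mean g y))"

text \<open>The rank-one matrix \<open>(D y)(1\<^sup>T D)\<close>, an \<open>N \<times> 1\<close> column times a \<open>1 \<times> N\<close> row; the constant
  \<open>1 :: real ^ 'n\<close> is the all-ones vector.\<close>

definition rank_one :: "real ^ 'n ^ 'n \<Rightarrow> real ^ 'n \<Rightarrow> real ^ 'n ^ 'n"
  where "rank_one D y =
    (columnvector (D *v y) :: real ^ 1 ^ 'n) ** (rowvector (1 v* D) :: real ^ 'n ^ 1)"

end

theory Submission
  imports Defs
begin

text \<open>On \<open>E\<close> the additive structure of \<open>f\<close> collapses the matrix to \<open>(B v)\<^sub>i = y\<^sub>i G - (g\<^sub>i + s) v\<^sub>i\<close>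
  with the single unknown scalar \<open>G = \<Sum>\<^sub>j g\<^sub>j v\<^sub>j\<close>. Solving for \<open>v\<^sub>i\<close> and summing over \<open>i\<close> gives
  \<open>G R\<^sub>0 = \<Sum>\<^sub>r h\<^sub>r / (g\<^sub>r + s)\<close>, which determines \<open>G\<close> because \<open>R\<^sub>0 > 0\<close>.\<close>

lemma MS_matrix_mult_zero_sum:
  fixes g :: "'n::finite \<Rightarrow> real"
  assumes f: "\<And>i j. i \<noteq> j \<Longrightarrow> f i j = g i + g j"
    and y: "y \<in> closed_simplex" and v: "v \<in> zero_sum"
  shows "(MS_matrix f y *v v) $ i = y $ i * (\<Sum>j\<in>UNIV. g j * v $ j) - (g i + g_mean g y) * v $ i"
proof -
  have sy: "(\<Sum>j\<in>UNIV. y $ j) = 1" and sv: "(\<Sum>j\<in>UNIV. v $ j) = 0"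
    using y v by (auto simp: closed_simplex_def zero_sum_def)
  \<comment> \<open>Adding the missing term \<open>j = i\<close>, with weight
    \<open>2 * g i\<close>, completes the sum. The vector is left general because the identity
    serves twice: for \<open>v\<close>, with coordinate sum 0, in the off-diagonal part, and for
    \<open>y\<close>, with coordinate sum 1, in the diagonal entry. The two corrections
    \<open>2 * g i * y $ i * v $ i\<close> then cancel.\<close>
  have weighted: "(\<Sum>j\<in>UNIV - {i}. f i j * x $ j)
      = g i * (\<Sum>j\<in>UNIV. x $ j) + (\<Sum>j\<in>UNIV. g j * x $ j) - 2 * g i * x $ i" for x :: "real ^ 'n"
  proof -
    have "(\<Sum>j\<in>UNIV - {i}. f i j * x $ j) = (\<Sum>j\<in>UNIV - {i}. (g i + g j) * x $ j)"
      by (rule sum.cong) (auto simp: f)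
    also have "\<dots> = (\<Sum>j\<in>UNIV. (g i + g j) * x $ j) - (g i + g i) * x $ i"
      by (simp add: sum_diff1)
    finally show ?thesis
      by (simp add: distrib_right sum.distrib sum_distrib_left)
  qed
  have "(MS_matrix f y *v v) $ i
      = MS_matrix f y $ i $ i * v $ i + (\<Sum>j\<in>UNIV - {i}. MS_matrix f y $ i $ j * v $ j)"
    by (simp add: matrix_vector_mult_def sum.remove[of UNIV i])
  also have "(\<Sum>j\<in>UNIV - {i}. MS_matrix f y $ i $ j * v $ j)
      = y $ i * (\<Sum>j\<in>UNIV - {i}. f i j * v $ j)"
    unfolding sum_distrib_left by (rule sum.cong) (auto simp: MS_matrix_def mult.assoc)
  also have "MS_matrix f y $ i $ i = - (\<Sum>j\<in>UNIV - {i}. f i j * y $ j)"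
    by (simp add: MS_matrix_def)
  finally show ?thesis
    unfolding weighted sy sv g_mean_def by (simp add: algebra_simps)
qed

lemma g_mean_nonneg:
  fixes g :: "'n::finite \<Rightarrow> real"
  assumes "\<And>i. g i > 0" "y \<in> closed_simplex"
  shows "g_mean g y \<ge> 0"
  unfolding g_mean_def using assms
  by (intro sum_nonneg mult_nonneg_nonneg) (auto simp: closed_simplex_def less_imp_le)

text \<open>All denominators are positive, so no term is negative; coordinates with sum 1 cannot all
  vanish, so some term is strictly positive.\<close>

lemma R0_pos:
  fixes g :: "'n::finite \<Rightarrow> real"
  assumes g: "\<And>i. g i > 0" and y: "y \<in> closed_simplex"
  shows "R0 g y > 0"
proof -
  have pos: "g i + g_mean g y > 0" for i
    using g g_mean_nonneg[where g = g, OF g y] by (simp add: add_pos_nonneg)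
  have y0: "y $ i \<ge> 0" for i
    using y by (simp add: closed_simplex_def)
  obtain i where "y $ i \<noteq> 0"
    using y by (force simp: closed_simplex_def)
  then have "y $ i / (g i + g_mean g y) > 0"
    using pos[of i] y0[of i] by simp
  then show ?thesis
    unfolding R0_def using pos y0 by (intro sum_pos2[where i = i]) (auto simp: less_imp_le)
qed

text \<open>Summing \<open>y $ i * G - (g i + s) * v $ i\<close> over \<open>i\<close> gives
  \<open>G - G\<close>, since \<open>y\<close> has sum 1 and the shift by \<open>s\<close>
  contributes \<open>s\<close> times the zero sum of \<open>v\<close>.\<close>

lemma MS_matrix_maps_zero_sum:
  fixes g :: "'n::finite \<Rightarrow> real"
  assumes f: "\<And>i j. i \<noteq> j \<Longrightarrow> f i j = g i + g j"
    and y: "y \<in> closed_simplex" and v: "v \<in> zero_sum"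
  shows "MS_matrix f y *v v \<in> zero_sum"
proof -
  have "(\<Sum>i\<in>UNIV. (g i + g_mean g y) * v $ i) = (\<Sum>i\<in>UNIV. g i * v $ i)"
    using v by (simp add: zero_sum_def distrib_right sum.distrib flip: sum_distrib_left)
  then show ?thesis
    using y by (simp add: zero_sum_def closed_simplex_def MS_matrix_mult_zero_sum[where f = f and g = g, OF f y v]
        sum_subtractf flip: sum_distrib_right)
qed

text \<open>The forward direction yields uniqueness, the backward one existence.\<close>

lemma MS_matrix_solution_iff:
  fixes g :: "'n::finite \<Rightarrow> real"
  assumes g: "\<And>i. g i > 0" and f: "\<And>i j. i \<noteq> j \<Longrightarrow> f i j = g i + g j"
    and y: "y \<in> closed_simplex" and s: "s = g_mean g y" and h: "h \<in> zero_sum"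
  shows "v \<in> zero_sum \<and> MS_matrix f y *v v = h \<longleftrightarrow>
    (\<forall>i. v $ i = - h $ i / (g i + s)
      + y $ i / (R0 g y * (g i + s)) * (\<Sum>r\<in>UNIV. h $ r / (g r + s)))"
    (is "?L \<longleftrightarrow> (\<forall>i. v $ i = ?v i)")
proof -
  \<comment> \<open>\<open>G\<close> depends on the candidate \<open>v\<close>, whereas
    \<open>K\<close> depends only on the data \<open>h\<close> and \<open>y\<close>: it is the value
    that the constraint of zero sum forces on \<open>G\<close>.\<close>
  define G where "G = (\<Sum>j\<in>UNIV. g j * v $ j)"
  define K where "K = (\<Sum>r\<in>UNIV. h $ r / (g r + s)) / R0 g y"
  have ne: "g i + s \<noteq> 0" for i
    using g[of i] g_mean_nonneg[where g = g, OF g y] s by simp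
  have R: "R0 g y > 0"
    by (rule R0_pos[where g = g, OF g y])
  have v_eq: "?v i = (y $ i * K - h $ i) / (g i + s)" for i
    using R ne[of i] by (simp add: K_def divide_simps)
  have KR: "K * R0 g y = (\<Sum>r\<in>UNIV. h $ r / (g r + s))"
    using R by (simp add: K_def)
  \<comment> \<open>The constant \<open>c\<close> is free: \<open>c = G\<close> turns the zero sum
    of a solution into \<open>G = K\<close>, and \<open>c = K\<close> shows that the explicit
    formula has zero sum.\<close>
  have sum_v: "(\<Sum>i\<in>UNIV. (y $ i * c - h $ i) / (g i + s)) = c * R0 g y - K * R0 g y" for c
    unfolding KR by (simp add: R0_def s diff_divide_distrib sum_subtractf sum_distrib_left mult.commute)
  have "G = K \<and> (\<forall>i. v $ i = ?v i)" if ?L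
  proof -
    have "h $ i = y $ i * G - (g i + s) * v $ i" for i
      using MS_matrix_mult_zero_sum[where f = f and g = g, OF f y, of v i] that by (simp add: G_def s)
    then have v: "v $ i = (y $ i * G - h $ i) / (g i + s)" for i
      using ne[of i] by (simp add: field_simps)
    have "G * R0 g y - K * R0 g y = (\<Sum>i\<in>UNIV. v $ i)"
      by (simp add: v flip: sum_v)
    then have "G = K"
      using that R by (simp add: zero_sum_def)
    then show ?thesis
      unfolding v_eq using v by simp
  qed
  moreover have ?L if v: "\<forall>i. v $ i = ?v i"
  proof -
    have v': "v $ i = (y $ i * K - h $ i) / (g i + s)" for i
      using v v_eq by simp
    have vE: "v \<in> zero_sum"
      by (simp add: zero_sum_def v' sum_v)
    have gv: "(g i + s) * v $ i = y $ i * K - h $ i" for i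
      using ne[of i] by (simp add: v')
    \<comment> \<open>The formula for \<open>v\<close> contains \<open>K\<close>, so
      \<open>G = K\<close> has to be recovered. Since \<open>v\<close> has zero sum, the weights
      \<open>g i\<close> may be shifted by \<open>s\<close>, which clears the denominators; then the
      sums of \<open>y\<close> and \<open>h\<close> are 1 and 0.\<close>
    have "G = (\<Sum>i\<in>UNIV. (g i + s) * v $ i)"
      using vE by (simp add: G_def zero_sum_def distrib_right sum.distrib flip: sum_distrib_left)
    also have "\<dots> = K"
      using y h by (simp add: gv sum_subtractf closed_simplex_def zero_sum_def flip: sum_distrib_right)
    finally have "MS_matrix f y *v v = h"
      using gv by (simp add: vec_eq_iff MS_matrix_mult_zero_sum[where f = f and g = g, OF f y vE] G_def s)
    with vE show ?thesis ..
  qed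
  ultimately show ?thesis by blast
qed

lemma D_mat_mult_nth: "(D_mat g s *v x) $ i = x $ i / (g i + s)"
  by (simp add: D_mat_def diag_matrix_def matrix_vector_mult_def if_distrib[where f = "\<lambda>a. a * _"]
      cong: if_cong)

lemma one_vector_mult_D_mat_nth: "(1 v* D_mat g s) $ i = 1 / (g i + s)"
  by (simp add: D_mat_def diag_matrix_def vector_matrix_mult_def cong: if_cong)

text \<open>The inner dimension of column times row is 1, so the product acts on \<open>h\<close> as
  the vector \<open>D y\<close> scaled by the number \<open>1\<^sup>T D h\<close>.\<close>

lemma rank_one_D_mat_mult_nth:
  "(rank_one (D_mat g s) y *v h) $ i = y $ i / (g i + s) * (\<Sum>r\<in>UNIV. h $ r / (g r + s))"
  by (simp add: rank_one_def matrix_matrix_mult_def matrix_vector_mult_def[of "vec_lambda _"]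
      columnvector_def rowvector_def D_mat_mult_nth one_vector_mult_D_mat_nth sum_distrib_left)

theorem proposition3p3:
  fixes g :: "'n::finite \<Rightarrow> real"
    and f :: "'n \<Rightarrow> 'n \<Rightarrow> real"
    and y :: "real ^ 'n"
    and s :: real
  assumes "CARD('n) \<ge> 2"
    and "\<And>i. g i > 0"
    and "\<And>i j. i \<noteq> j \<Longrightarrow> f i j = g i + g j"
    and "y \<in> closed_simplex"
    and "s = g_mean g y"
  shows "(\<forall>h \<in> zero_sum. \<exists>!v. v \<in> zero_sum \<and> MS_matrix f y *v v = h)
    \<and> R0 g y > 0
    \<and> bij_betw (\<lambda>v. MS_matrix f y *v v) zero_sum zero_sum
    \<and> (\<forall>h \<in> zero_sum.
          the_inv_into zero_sum (\<lambda>v. MS_matrix f y *v v) h =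
            (- D_mat g s + (1 / R0 g y) *\<^sub>R rank_one (D_mat g s) y) *v h)
    \<and> (\<forall>h \<in> zero_sum. \<forall>v.
          v \<in> zero_sum \<and> MS_matrix f y *v v = h \<longleftrightarrow>
            (\<forall>i. v $ i = - h $ i / (g i + s)
              + y $ i / (R0 g y * (g i + s)) * (\<Sum>r\<in>UNIV. h $ r / (g r + s))))"
proof -
  let ?B = "\<lambda>v. MS_matrix f y *v v"
  let ?w = "\<lambda>h. (- D_mat g s + (1 / R0 g y) *\<^sub>R rank_one (D_mat g s) y) *v h"
  have iff: "v \<in> zero_sum \<and> ?B v = h \<longleftrightarrow> (\<forall>i. v $ i = - h $ i / (g i + s)
      + y $ i / (R0 g y * (g i + s)) * (\<Sum>r\<in>UNIV. h $ r / (g r + s)))"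
    if "h \<in> zero_sum" for v h
    by (rule MS_matrix_solution_iff[where f = f and g = g, OF assms(2,3,4,5) that])
  have "?w h $ i = - h $ i / (g i + s)
      + y $ i / (R0 g y * (g i + s)) * (\<Sum>r\<in>UNIV. h $ r / (g r + s))" for h i
  proof -
    have "?w h = - (D_mat g s *v h) + (1 / R0 g y) *\<^sub>R (rank_one (D_mat g s) y *v h)"
      by (simp add: matrix_vector_mult_diff_rdistrib scaleR_matrix_vector_assoc)
    then show ?thesis
      by (simp add: D_mat_mult_nth rank_one_D_mat_mult_nth)
  qed
  \<comment> \<open>This single equivalence, with the invariance of \<open>zero_sum\<close>, makes
    \<open>?w\<close> a two-sided inverse of \<open>?B\<close> there; bijectivity and the inverse
    formula follow formally.\<close>
  then have sol: "v \<in> zero_sum \<and> ?B v = h \<longleftrightarrow> v = ?w h" if "h \<in> zero_sum" for v h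
    by (subst iff[OF that]) (simp only: vec_eq_iff)
  have maps: "?B v \<in> zero_sum" if "v \<in> zero_sum" for v
    by (rule MS_matrix_maps_zero_sum[where f = f and g = g, OF assms(3,4) that])
  have w: "?w h \<in> zero_sum \<and> ?B (?w h) = h" if "h \<in> zero_sum" for h
    by (rule sol[OF that, THEN iffD2]) (rule refl)
  \<comment> \<open>Take \<open>?B v\<close> as the right-hand side: \<open>v\<close> itself solves
    that equation, so it equals \<open>?w (?B v)\<close>.\<close>
  have w_B: "?w (?B v) = v" if "v \<in> zero_sum" for v
    by (rule sol[OF maps[OF that], THEN iffD1, symmetric]) (rule conjI[OF that refl])
  have inj: "inj_on ?B zero_sum"
    by (rule inj_on_inverseI[where g = ?w, OF w_B])
  have surj: "?B ` zero_sum = zero_sum"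
  proof
    show "?B ` zero_sum \<subseteq> zero_sum"
      by (rule image_subsetI) (rule maps)
    show "zero_sum \<subseteq> ?B ` zero_sum"
    proof
      fix h :: "real ^ 'n" assume "h \<in> zero_sum"
      from w[OF this] show "h \<in> ?B ` zero_sum"
        by (metis imageI)
    qed
  qed
  have inv: "the_inv_into zero_sum ?B h = ?w h" if "h \<in> zero_sum" for h
    by (rule the_inv_into_f_eq[OF inj]) (use w[OF that] in blast)+
  have ex1: "\<exists>!v. v \<in> zero_sum \<and> ?B v = h" if "h \<in> zero_sum" for h
    unfolding sol[OF that] by blast
  show ?thesis
    unfolding bij_betw_def
    by (intro conjI ballI allI ex1 R0_pos[where g = g, OF assms(2,4)] inj surj inv iff)
qed

end
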